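(* For integers $n\ge k\ge 0$, $$\sum_{l=0}^{n-k}\binom{n-k}{l}(-1)^l\xi_{k+l,q}=\sum_{l=0}^{k}\binom{k}{l}(-1)^{k+l}\xi_{n-l,1/q}(2).$$
   Context: Let $p$ be an odd prime, $\mathbb{C}_p$ the completion of an algebraic closure of $\mathbb{Q}_p$, and $q\in\mathbb{C}_p$ with $|1-q|_p<1$ (then also $|1-q^{-1}|_p<1$). For $Q\in\{q,q^{-1}\}$ put $[x]_Q=\frac{1-Q^x}{1-Q}$. The $Q$-Euler numbers $\xi_{n,Q}$ are defined by $\xi_{0,Q}=1$ and, for $n\ge 1$, $Q\sum_{l=0}^{n}\binom{n}{l}Q^l\xi_{l,Q}+\xi_{n,Q}=0$. The $Q$-Euler polynomials are $\xi_{n,Q}(x)=\sum_{l=0}^{n}\binom{n}{l}[x]_Q^{\,n-l}Q^{lx}\xi_{l,Q}$; $\xi_{n,1/q}(x)$ denotes these for $Q=q^{-1}$. *)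

theory Defs
  imports Complex_Main "HOL-Computational_Algebra.Computational_Algebra"
begin

definition padic_abs :: "nat \<Rightarrow> rat \<Rightarrow> real" where
  "padic_abs p r =
     (if r = 0 then 0
      else real p powi (int (multiplicity (int p) (snd (quotient_of r)))
                      - int (multiplicity (int p) (fst (quotient_of r)))))"

text \<open>
  A field with an absolute value \<open>v\<close> is ``the'' field of complex \<open>p\<close>-adic numbers if it is the
  completion of an algebraic closure of the \<open>p\<close>-adic numbers.  Inside such a field the \<open>p\<close>-adic
  numbers are the \<open>v\<close>-closure of the rationals, and their algebraic closure is the set of all
  elements algebraic over them.  This determines the pair of field and absolute value up to
  isometric isomorphism.
\<close>

definition v_closure :: "('a::field_char_0 \<Rightarrow> real) \<Rightarrow> 'a set \<Rightarrow> 'a set" where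
  "v_closure v S = {x. \<forall>e>0. \<exists>y\<in>S. v (x - y) < e}"

definition v_complete :: "('a::field_char_0 \<Rightarrow> real) \<Rightarrow> bool" where
  "v_complete v \<longleftrightarrow>
     (\<forall>X :: nat \<Rightarrow> 'a.
        (\<forall>e>0. \<exists>N. \<forall>m\<ge>N. \<forall>n\<ge>N. v (X m - X n) < e) \<longrightarrow>
        (\<exists>L. (\<lambda>n. v (X n - L)) \<longlonglongrightarrow> 0))"

definition algebraic_elements :: "'a::field_char_0 set \<Rightarrow> 'a set" where
  "algebraic_elements F =
     {x. \<exists>P. P \<noteq> 0 \<and> (\<forall>i. coeff P i \<in> F) \<and> poly P x = 0}"

definition alg_closed_subset :: "'a::field_char_0 set \<Rightarrow> bool" where
  "alg_closed_subset A \<longleftrightarrow>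
     (\<forall>P. (\<forall>i. coeff P i \<in> A) \<and> degree P > 0 \<longrightarrow> (\<exists>z\<in>A. poly P z = 0))"

locale complex_padic =
  fixes p :: nat and v :: "'a::field_char_0 \<Rightarrow> real"
  assumes v_nonneg: "0 \<le> v x"
    and v_eq_0_iff: "v x = 0 \<longleftrightarrow> x = 0"
    and v_mult: "v (x * y) = v x * v y"
    and v_ultrametric: "v (x + y) \<le> max (v x) (v y)"
    and v_of_rat: "v (of_rat r) = padic_abs p r"
    and v_complete: "v_complete v"
    and alg_closed: "alg_closed_subset (algebraic_elements (v_closure v \<rat>))"
    and alg_dense: "v_closure v (algebraic_elements (v_closure v \<rat>)) = UNIV"

text \<open>At \<open>Q = 1\<close> the quotient \<open>(1 - Q\<^sup>x) / (1 - Q)\<close> is read as its limit \<open>x\<close>.\<close>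

definition qbracket :: "'a::field_char_0 \<Rightarrow> int \<Rightarrow> 'a" where
  "qbracket Q x = (if Q = 1 then of_int x else (1 - Q powi x) / (1 - Q))"

definition is_qEuler_seq :: "'a::field_char_0 \<Rightarrow> (nat \<Rightarrow> 'a) \<Rightarrow> bool" where
  "is_qEuler_seq Q \<xi> \<longleftrightarrow>
     \<xi> 0 = 1 \<and>
     (\<forall>n\<ge>1. Q * (\<Sum>l=0..n. of_nat (n choose l) * Q ^ l * \<xi> l) + \<xi> n = 0)"

text \<open>
  The \<open>n\<close>-th equation has the coefficient \<open>1 + Q\<^bsup>n+1\<^esup>\<close> at \<open>\<xi> n\<close>, so the sequence is well defined
  as soon as none of these vanishes; this is the content of \<open>is_qEuler_seq_ex1\<close> and, for \<open>p\<close> odd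
  and \<open>v (1 - Q) < 1\<close>, of \<open>complex_padic.is_qEuler_seq_qEuler\<close> below.
\<close>

definition qEuler :: "'a::field_char_0 \<Rightarrow> nat \<Rightarrow> 'a" where
  "qEuler Q = (THE \<xi>. is_qEuler_seq Q \<xi>)"

definition qEuler_poly :: "'a::field_char_0 \<Rightarrow> nat \<Rightarrow> int \<Rightarrow> 'a" where
  "qEuler_poly Q n x =
     (\<Sum>l=0..n. of_nat (n choose l) * qbracket Q x ^ (n - l) * Q powi (int l * x) * qEuler Q l)"

fun qEuler_rec :: "'a::field_char_0 \<Rightarrow> nat \<Rightarrow> 'a" where
  "qEuler_rec Q n =
     (if n = 0 then 1
      else - Q * (\<Sum>l<n. of_nat (n choose l) * Q ^ l * qEuler_rec Q l) / (1 + Q ^ Suc n))"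

declare qEuler_rec.simps [simp del]

lemma qEuler_step_iff:
  fixes Q :: "'a::field_char_0"
  assumes "1 + Q ^ Suc n \<noteq> 0"
  shows "Q * (\<Sum>l=0..n. of_nat (n choose l) * Q ^ l * f l) + f n = 0 \<longleftrightarrow>
         f n = - Q * (\<Sum>l<n. of_nat (n choose l) * Q ^ l * f l) / (1 + Q ^ Suc n)"
proof -
  let ?S = "\<Sum>l<n. of_nat (n choose l) * Q ^ l * f l"
  have "(\<Sum>l=0..n. of_nat (n choose l) * Q ^ l * f l) = ?S + Q ^ n * f n"
    by (simp add: atLeast0AtMost flip: lessThan_Suc_atMost)
  then have "Q * (\<Sum>l=0..n. of_nat (n choose l) * Q ^ l * f l) + f n
             = f n * (1 + Q ^ Suc n) - (- Q * ?S)"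
    by (simp add: algebra_simps)
  then show ?thesis
    using assms unfolding eq_divide_eq by (simp only: right_minus_eq not_False_eq_True if_True)
qed

lemma is_qEuler_seq_ex1:
  fixes Q :: "'a::field_char_0"
  assumes "\<And>n. 1 + Q ^ Suc n \<noteq> 0"
  shows "\<exists>!\<xi>. is_qEuler_seq Q \<xi>"
proof
  show "is_qEuler_seq Q (qEuler_rec Q)"
    unfolding is_qEuler_seq_def
  proof (intro conjI allI impI)
    show "qEuler_rec Q 0 = 1" by (simp add: qEuler_rec.simps)
    fix n :: nat assume "n \<ge> 1"
    then show "Q * (\<Sum>l=0..n. of_nat (n choose l) * Q ^ l * qEuler_rec Q l) + qEuler_rec Q n = 0"
      unfolding qEuler_step_iff[OF assms] by (subst qEuler_rec.simps) simp
  qed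
next
  fix f assume f: "is_qEuler_seq Q f"
  have "f n = qEuler_rec Q n" for n
  proof (induction n rule: less_induct)
    case (less n)
    show ?case
    proof (cases "n = 0")
      case True
      then show ?thesis using f by (simp add: is_qEuler_seq_def qEuler_rec.simps)
    next
      case False
      then have "f n = - Q * (\<Sum>l<n. of_nat (n choose l) * Q ^ l * f l) / (1 + Q ^ Suc n)"
        using f qEuler_step_iff[OF assms, of n f] by (simp add: is_qEuler_seq_def)
      also have "(\<Sum>l<n. of_nat (n choose l) * Q ^ l * f l)
                 = (\<Sum>l<n. of_nat (n choose l) * Q ^ l * qEuler_rec Q l)"
        using less.IH by (intro sum.cong) auto
      finally show ?thesis using False by (subst qEuler_rec.simps) simp
    qed
  qed
  then show "f = qEuler_rec Q" by blast
qed

context complex_padic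
begin

lemma v_1: "v 1 = 1"
  using v_mult[of 1 1] v_eq_0_iff[of 1] by simp

lemma v_minus: "v (- x) = v x"
proof -
  have "v (- 1) * v (- 1) = 1" using v_mult[of "-1" "-1"] v_1 by simp
  then have "v (- 1) = 1" using v_nonneg[of "-1"] by (simp add: square_eq_1_iff)
  then show ?thesis using v_mult[of "-1" x] by simp
qed

lemma v_2:
  assumes "prime p" "odd p"
  shows "v 2 = 1"
proof -
  have "\<not> int p dvd 2"
  proof
    assume "int p dvd 2"
    then have "p dvd 2" by presburger
    then have "p \<le> 2" by (auto dest: dvd_imp_le)
    with assms prime_gt_1_nat[of p] have "p = 2" by linarith
    with assms show False by simp
  qed
  then have "multiplicity (int p) 2 = 0" by (rule not_dvd_imp_multiplicity_0)
  moreover have "quotient_of 2 = (2, 1)" by simp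
  ultimately have "padic_abs p 2 = 1" by (simp add: padic_abs_def)
  then show ?thesis using v_of_rat[of 2] by simp
qed

lemma one_plus_power_nonzero:
  assumes "prime p" "odd p" and Q: "v (1 - Q) < 1"
  shows "1 + Q ^ m \<noteq> 0"
proof
  assume *: "1 + Q ^ m = 0"
  have Q1: "v Q \<le> 1"
    using v_ultrametric[of 1 "- (1 - Q)"] v_1 v_minus[of "1 - Q"] Q by simp
  have "v (1 - Q ^ m) < 1" for m
  proof (induction m)
    case 0
    then show ?case using v_eq_0_iff[of 0] by simp
  next
    case (Suc m)
    have "v (Q * (1 - Q ^ m)) < 1"
      using Suc Q1 v_mult[of Q "1 - Q ^ m"] v_nonneg[of "1 - Q ^ m"] v_nonneg[of Q]
        mult_left_le_one_le[of "v (1 - Q ^ m)" "v Q"] by linarith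
    moreover have "1 - Q ^ Suc m = (1 - Q) + Q * (1 - Q ^ m)" by (simp add: algebra_simps)
    ultimately show ?case
      using v_ultrametric[of "1 - Q" "Q * (1 - Q ^ m)"] Q by (simp only: max_def split: if_splits)
  qed
  from this[of m] have "v (1 - Q ^ m) < 1" .
  moreover have "1 - Q ^ m = 2" using * by (simp add: eq_neg_iff_add_eq_0[symmetric] algebra_simps)
  ultimately show False using v_2[OF assms(1,2)] by simp
qed

lemma is_qEuler_seq_qEuler:
  assumes "prime p" "odd p" "v (1 - Q) < 1"
  shows "is_qEuler_seq Q (qEuler Q)"
  unfolding qEuler_def
  by (rule theI'[where P = "is_qEuler_seq Q"])
    (rule is_qEuler_seq_ex1[OF one_plus_power_nonzero[OF assms]])

end

end

theory Submission
  imports Defs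
begin

text \<open>
  Let \<open>L\<close> be the linear functional on polynomials with \<open>L(X\<^sup>n) = \<xi>\<^bsub>n,q\<^esub>\<close>; it plays the role of the
  fermionic \<open>p\<close>-adic integral, with \<open>X\<close> standing for \<open>[x]\<^sub>q\<close>.  The recurrence says that
  \<open>q L(P(1 + qX)) + L(P) = (1 + q) P(0)\<close> for every polynomial \<open>P\<close>.  Applied to \<open>P(-qX)\<close> it shows
  that \<open>P \<mapsto> L(P(-q - q\<^sup>2X))\<close> satisfies the same identity with \<open>1/q\<close> in place of \<open>q\<close>, so by
  uniqueness \<open>\<xi>\<^bsub>n,1/q\<^esub> = L((-q - q\<^sup>2X)\<^sup>n)\<close> and therefore \<open>\<xi>\<^bsub>n,1/q\<^esub>(2) = L((1 - X)\<^sup>n)\<close>.  Both sides of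
  the theorem are then expansions of \<open>L(X\<^sup>k (1 - X)\<^bsup>n-k\<^esup>)\<close>.
\<close>

definition umbral :: "(nat \<Rightarrow> 'a::comm_ring_1) \<Rightarrow> 'a poly \<Rightarrow> 'a" where
  "umbral f P = (\<Sum>i\<le>degree P. coeff P i * f i)"

lemma umbral_degree_le:
  assumes "degree P \<le> N"
  shows "umbral f P = (\<Sum>i\<le>N. coeff P i * f i)"
  unfolding umbral_def
  by (rule sum.mono_neutral_left) (use assms in \<open>auto simp: coeff_eq_0\<close>)

lemma umbral_add: "umbral f (P + R) = umbral f P + umbral f R"
proof -
  let ?N = "max (degree P) (degree R)"
  have "degree (P + R) \<le> ?N"
    by (simp add: degree_add_le)
  then show ?thesis
    by (simp add: umbral_degree_le[where N = ?N] sum.distrib distrib_right)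
qed

lemma umbral_smult: "umbral f (smult c P) = c * umbral f P"
  using umbral_degree_le[OF degree_smult_le, of f c P]
  by (simp add: umbral_def sum_distrib_left mult.assoc)

lemma umbral_sum: "umbral f (\<Sum>i\<in>A. P i) = (\<Sum>i\<in>A. umbral f (P i))"
  by (induction A rule: infinite_finite_induct) (simp_all add: umbral_add umbral_def[of f 0])

lemma umbral_X_power: "umbral f ([:0, 1:] ^ n) = f n"
proof -
  have X: "[:0, 1:] ^ n = monom (1::'a) n"
    by (simp add: monom_altdef)
  have "umbral f (monom 1 n) = (\<Sum>i\<le>n. coeff (monom 1 n) i * f i)"
    by (rule umbral_degree_le) (rule degree_monom_le)
  also have "\<dots> = (\<Sum>i\<le>n. if i = n then f i else 0)"
    by (rule sum.cong) auto
  finally show ?thesis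
    by (simp add: X)
qed

lemma binomial_smult:
  fixes A B :: "'a::comm_ring_1 poly"
  shows "(smult a A + smult b B) ^ n =
    (\<Sum>l=0..n. smult (of_nat (n choose l) * a ^ l * b ^ (n - l)) (A ^ l * B ^ (n - l)))"
  by (simp add: binomial_ring smult_power of_nat_poly mult.commute mult.left_commute
      atLeast0AtMost)

text \<open>Later expansions under the functional use this form: a linear polynomial is split into
  two simpler ones, often with \<open>B = 1\<close>.\<close>

lemma umbral_binomial:
  "umbral f ((smult a A + smult b B) ^ n) =
   (\<Sum>l=0..n. of_nat (n choose l) * a ^ l * b ^ (n - l) * umbral f (A ^ l * B ^ (n - l)))"
  by (simp only: binomial_smult umbral_sum umbral_smult)

lemma pcompose_power: "(P ^ n) \<circ>\<^sub>p R = (P \<circ>\<^sub>p R :: 'a::comm_ring_1 poly) ^ n"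
  by (induction n) (simp_all add: pcompose_mult pcompose_1)

lemma poly_eq_sum_X_powers:
  fixes P :: "'a::comm_ring_1 poly"
  shows "P = (\<Sum>i\<le>degree P. smult (coeff P i) ([:0, 1:] ^ i))"
  by (simp flip: monom_altdef add: poly_as_sum_of_monoms)

lemma umbral_qEuler:
  fixes P :: "'a::field_char_0 poly"
  assumes "is_qEuler_seq q f"
  shows "q * umbral f (P \<circ>\<^sub>p [:1, q:]) + umbral f P = (1 + q) * poly P 0"
proof -
  \<comment> \<open>The case \<open>P = X^n\<close>, where \<open>0 ^ n\<close> is
    \<open>P(0)\<close>: for \<open>n = 0\<close> it follows from \<open>f 0 = 1\<close>, otherwise
    it is the recurrence. Linearity gives the rest.\<close>
  have X: "q * umbral f ([:1, q:] ^ n) + f n = (1 + q) * 0 ^ n" for n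
  proof -
    have "[:1, q:] = smult q [:0, 1:] + smult 1 1"
      by (simp add: one_pCons)
    then have "umbral f ([:1, q:] ^ n) = (\<Sum>l=0..n. of_nat (n choose l) * q ^ l * f l)"
      by (simp only: umbral_binomial power_one mult_1_right umbral_X_power)
    then show ?thesis
      using assms by (cases "n = 0") (auto simp: is_qEuler_seq_def)
  qed
  let ?c = "coeff P" and ?D = "{..degree P}"
  have "P \<circ>\<^sub>p [:1, q:] = (\<Sum>i\<in>?D. smult (?c i) ([:1, q:] ^ i))"
    by (subst poly_eq_sum_X_powers[of P])
      (simp add: pcompose_sum pcompose_smult pcompose_power pcompose_pCons)
  then have "q * umbral f (P \<circ>\<^sub>p [:1, q:]) + umbral f P =
        (\<Sum>i\<in>?D. ?c i * (q * umbral f ([:1, q:] ^ i) + f i))"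
    by (simp add: umbral_sum umbral_smult umbral_def[of f P] sum_distrib_left sum.distrib
        algebra_simps)
  also have "\<dots> = (1 + q) * (\<Sum>i\<in>?D. ?c i * 0 ^ i)"
    unfolding X sum_distrib_left by (intro sum.cong refl) (rule mult.left_commute)
  finally show ?thesis
    by (simp add: poly_altdef)
qed

text \<open>The polynomial -q - q^2 X stands for the bracket of -1-x to base 1/q, so this is the
  reflection of x to -1-x.\<close>

lemma is_qEuler_seq_inverse:
  fixes q :: "'a::field_char_0"
  assumes f: "is_qEuler_seq q f" and q: "q \<noteq> 0"
  shows "is_qEuler_seq (1 / q) (\<lambda>n. umbral f ([:- q, - (q\<^sup>2):] ^ n))"
  unfolding is_qEuler_seq_def
proof (intro conjI allI impI)
  show "umbral f ([:- q, - (q\<^sup>2):] ^ 0) = 1"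
    using f by (simp add: umbral_def is_qEuler_seq_def)
  fix n :: nat assume n: "n \<ge> 1"
  let ?A = "[:- q, - (q\<^sup>2):]" and ?R = "[:0, - q:] ^ n"
  have "smult (1 / q) ?A + smult 1 1 = [:0, - q:]"
    using q by (simp add: one_pCons power2_eq_square)
  then have "umbral f ?R = umbral f ((smult (1 / q) ?A + smult 1 1) ^ n)"
    by simp
  then have R: "umbral f ?R =
      (\<Sum>l=0..n. of_nat (n choose l) * (1 / q) ^ l * umbral f (?A ^ l))"
    by (simp only: umbral_binomial power_one mult_1_right)
  have "?R \<circ>\<^sub>p [:1, q:] = ?A ^ n"
    by (simp add: pcompose_power pcompose_pCons power2_eq_square)
  \<comment> \<open>The right-hand side vanishes because \<open>?R\<close> has value 0 at 0 for
    \<open>n \<ge> 1\<close>.\<close>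
  then have "q * umbral f (?A ^ n) + umbral f ?R = 0"
    using umbral_qEuler[OF f, of ?R] n by (simp add: poly_power)
  then show "1 / q * (\<Sum>l=0..n. of_nat (n choose l) * (1 / q) ^ l * umbral f (?A ^ l)) +
      umbral f (?A ^ n) = 0"
    unfolding R[symmetric] using q by (simp add: field_simps)
qed

lemma qEuler_eqI:
  assumes "\<And>n. 1 + Q ^ Suc n \<noteq> 0" and "is_qEuler_seq Q f"
  shows "qEuler Q = f"
  unfolding qEuler_def
  by (rule the1_equality[of "is_qEuler_seq Q", OF is_qEuler_seq_ex1[OF assms(1)] assms(2)])

lemma qEuler_poly_inverse_2:
  fixes q :: "'a::field_char_0"
  assumes f: "is_qEuler_seq q f" and q: "q \<noteq> 0" and nz: "\<And>m. 1 + q ^ m \<noteq> 0"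
  shows "qEuler_poly (1 / q) n 2 = umbral f ([:1, - 1:] ^ n)"
proof -
  let ?A = "[:- q, - (q\<^sup>2):]"
  have "1 + (1 / q) ^ m = (1 + q ^ m) / q ^ m" for m
    using q by (simp add: field_simps)
  then have "1 + (1 / q) ^ Suc m \<noteq> 0" for m
    using nz q by (simp del: power_Suc)
  then have E: "qEuler (1 / q) = (\<lambda>n. umbral f (?A ^ n))"
    by (rule qEuler_eqI) (rule is_qEuler_seq_inverse[OF f q])
  have br: "qbracket (1 / q) 2 = 1 + 1 / q"
  \<comment> \<open>At \<open>q = 1\<close> the bracket is 2 by convention, in agreement with
    \<open>1 + 1 / q\<close>.\<close>
  proof (cases "q = 1")
    case False
    then have "1 - 1 / q \<noteq> 0"
      using q by (simp add: field_simps)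
    moreover have "1 - (1 / q) powi 2 = (1 + 1 / q) * (1 - 1 / q)"
      by (simp add: power2_eq_square algebra_simps)
    ultimately show ?thesis
      by (simp add: qbracket_def)
  qed (simp add: qbracket_def)
  have pw: "(1 / q) powi (int l * 2) = ((1 / q)\<^sup>2) ^ l" for l
    by (simp add: mult.commute[of _ 2] power_int_mult)
  \<comment> \<open>The addition rule [2+y] = [2] + Q^2 [y] with Q = 1/q and y = -1-x.\<close>
  have "[:1, - 1:] = smult ((1 / q)\<^sup>2) ?A + smult (1 + 1 / q) 1"
    using q by (simp add: one_pCons field_simps power2_eq_square)
  then have "umbral f ([:1, - 1:] ^ n) =
      (\<Sum>l=0..n. of_nat (n choose l) * ((1 / q)\<^sup>2) ^ l * (1 + 1 / q) ^ (n - l) * umbral f (?A ^ l))"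
    by (simp only: umbral_binomial power_one mult_1_right)
  also have "\<dots> = qEuler_poly (1 / q) n 2"
    unfolding qEuler_poly_def E br pw by (rule sum.cong) (simp_all only: mult_ac)
  finally show ?thesis ..
qed

lemma sum_umbral_X:
  "(\<Sum>l=0..m. of_nat (m choose l) * (- 1) ^ l * f (k + l)) =
   umbral f ([:0, 1:] ^ k * [:1, - 1:] ^ m)"
proof -
  have "[:0, 1:] ^ k * [:1, - 1:] ^ m =
      [:0, 1:] ^ k * (smult (- 1) [:0, 1:] + smult 1 1 :: 'a poly) ^ m"
    by (simp add: one_pCons)
  also have "\<dots> = (\<Sum>l=0..m. smult (of_nat (m choose l) * (- 1) ^ l) ([:0, 1:] ^ (k + l)))"
    by (simp only: binomial_smult sum_distrib_left mult_smult_right power_one mult_1_right power_add)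
  finally show ?thesis
    by (simp only: umbral_sum umbral_smult umbral_X_power)
qed

text \<open>Write X = 1 - (1 - X) and expand only the factor X^k, in powers of 1 - X.\<close>

lemma sum_umbral_one_minus_X:
  assumes "k \<le> n"
  shows "(\<Sum>l=0..k. of_nat (k choose l) * (- 1) ^ (k + l) * umbral f ([:1, - 1:] ^ (n - l))) =
         umbral f ([:0, 1:] ^ k * [:1, - 1:] ^ (n - k))"
proof -
  let ?Y = "[:1, - 1:] :: 'a poly"
  have "[:0, 1:] ^ k * ?Y ^ (n - k) = (smult 1 1 + smult (- 1) ?Y) ^ k * ?Y ^ (n - k)"
    by (simp add: one_pCons)
  also have "\<dots> =
      (\<Sum>l=0..k. smult (of_nat (k choose l) * (- 1) ^ (k - l)) (?Y ^ (k - l) * ?Y ^ (n - k)))"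
    by (simp only: binomial_smult sum_distrib_right mult_smult_left power_one mult_1_right
        mult_1_left)
  \<comment> \<open>\<open>k - l\<close> and \<open>k + l\<close> have equal parity, and the
    exponents add up to \<open>n - l\<close> since \<open>l \<le> k \<le> n\<close>.\<close>
  also have "\<dots> = (\<Sum>l=0..k. smult (of_nat (k choose l) * (- 1) ^ (k + l)) (?Y ^ (n - l)))"
    using assms by (intro sum.cong refl) (simp add: minus_one_power_iff flip: power_add)
  finally show ?thesis
    by (simp only: umbral_sum umbral_smult)
qed

theorem theorem6:
  fixes p :: nat and v :: "'a::field_char_0 \<Rightarrow> real" and q :: 'a and n k :: nat
  assumes "prime p" and "odd p"
    and "complex_padic p v"
    and "v (1 - q) < 1"
    and "k \<le> n"
  shows "(\<Sum>l=0..n - k. of_nat ((n - k) choose l) * (- 1) ^ l * qEuler q (k + l)) =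
         (\<Sum>l=0..k. of_nat (k choose l) * (- 1) ^ (k + l) * qEuler_poly (1 / q) (n - l) 2)"
proof -
  interpret complex_padic p v by fact
  \<comment> \<open>For \<open>q = 0\<close> the value \<open>v (1 - q)\<close> would be 1.\<close>
  have "q \<noteq> 0"
    using assms(4) v_1 by auto
  then have "qEuler_poly (1 / q) m 2 = umbral (qEuler q) ([:1, - 1:] ^ m)" for m
    using qEuler_poly_inverse_2[OF is_qEuler_seq_qEuler] one_plus_power_nonzero assms(1,2,4)
    by blast
  then show ?thesis
    by (simp only: sum_umbral_X sum_umbral_one_minus_X[OF assms(5)])
qed

end
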